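(* Let $L\subseteq\Sigma^*$ be a regular language and let $k\ge 1$ be an integer. Then the pre-image $\mathsf{Pre}_{\rightsquigarrow_s^{(k)}}(L)=\{\sigma\in\Sigma^* : \exists\rho\in L,\ \sigma\rightsquigarrow_s^{(k)}\rho\}$ is a regular language.
   Context: Given finite sets $\mathcal{T}$ (threads) and $\mathcal{X}$ (memory locations), let $\Sigma=\{\langle t,op(x)\rangle : t\in\mathcal{T},\ op\in\{\mathtt{w},\mathtt{r}\},\ x\in\mathcal{X}\}$ ($\mathtt{w}$ = write, $\mathtt{r}$ = read). A run is a finite word $\sigma\in\Sigma^*$; the occurrences of letters in it are its events. The reads-from map $\mathsf{rf}_\sigma$ is the partial map sending each read event on a location $x$ to the last write event on $x$ preceding it in $\sigma$, undefined if there is no such write. Reads-from equivalence: $\sigma\equiv_{\mathsf{rf}}\rho$ iff for every thread $t$ the subsequence of events of thread $t$ is the same in $\sigma$ and $\rho$ (same events and same program order; so the $j$-th event of thread $t$ in $\sigma$ is identified with the $j$-th event of thread $t$ in $\rho$), and, under this identification, $\mathsf{rf}_\sigma=\mathsf{rf}_\rho$. $k$-sliced reordering: $\sigma\rightsquigarrow_s^{(k)}\rho$ iff $\sigma\equiv_{\mathsf{rf}}\rho$ and the events of $\sigma$ can be partitioned into $k+1$ disjoint (possibly empty) subsequences $\sigma_1,\dots,\sigma_{k+1}$ of $\sigma$ such that $\rho=\sigma_1\cdot\sigma_2\cdots\sigma_{k+1}$ as sequences of events (identifying, for every thread $t$ and every $j$, the $j$-th event of thread $t$ in $\sigma$ with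 the $j$-th event of thread $t$ in $\rho$). *)

theory Defs
  imports Main "HOL-Library.Disjoint_Sets"
begin

datatype op_kind = Write | Read

datatype ('t, 'x) letter = Letter (thread: 't) (kind: op_kind) (loc: 'x)

definition alphabet :: "'t set \<Rightarrow> 'x set \<Rightarrow> ('t, 'x) letter set" where
  "alphabet T X = {Letter t p x | t p x. t \<in> T \<and> x \<in> X}"

text \<open>
  A language over a finite alphabet is regular if it is recognised by a complete deterministic
  finite automaton. Every finite state set is in bijection with a set of natural numbers, so
  states are drawn from \<^typ>\<open>nat\<close>. In particular, a regular language over \<open>A\<close> is
  a subset of \<open>lists A\<close>.
\<close>

definition regular_lang :: "'a set \<Rightarrow> 'a list set \<Rightarrow> bool" where
  "regular_lang A L \<longleftrightarrow>
     (\<exists>(Q :: nat set) q0 F \<delta>.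
        finite Q \<and> q0 \<in> Q \<and> F \<subseteq> Q \<and> (\<forall>q\<in>Q. \<forall>a\<in>A. \<delta> q a \<in> Q) \<and>
        L = {w \<in> lists A. foldl \<delta> q0 w \<in> F})"

definition thread_proj :: "'t \<Rightarrow> ('t, 'x) letter list \<Rightarrow> ('t, 'x) letter list" where
  "thread_proj t \<sigma> = filter (\<lambda>a. thread a = t) \<sigma>"

text \<open>
  The events of a run are its positions \<open>i < length \<sigma>\<close>. To identify events of different
  runs, the event at position \<open>i\<close> is named by the pair \<open>(t, j)\<close>, where \<open>t\<close> is its thread
  and \<open>j\<close> (counted from 0) its index among the events of \<open>t\<close>.
\<close>

definition event_id :: "('t, 'x) letter list \<Rightarrow> nat \<Rightarrow> 't \<times> nat" where
  "event_id \<sigma> i = (thread (\<sigma> ! i), card {i'. i' < i \<and> thread (\<sigma> ! i') = thread (\<sigma> ! i)})"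

definition event_seq :: "('t, 'x) letter list \<Rightarrow> ('t \<times> nat) list" where
  "event_seq \<sigma> = map (event_id \<sigma>) [0..<length \<sigma>]"

definition writes_before :: "('t, 'x) letter list \<Rightarrow> nat \<Rightarrow> nat set" where
  "writes_before \<sigma> i = {j. j < i \<and> kind (\<sigma> ! j) = Write \<and> loc (\<sigma> ! j) = loc (\<sigma> ! i)}"

definition rf :: "('t, 'x) letter list \<Rightarrow> nat \<rightharpoonup> nat" where
  "rf \<sigma> i =
     (if i < length \<sigma> \<and> kind (\<sigma> ! i) = Read \<and> writes_before \<sigma> i \<noteq> {}
      then Some (Max (writes_before \<sigma> i)) else None)"

definition rf_equiv :: "('t, 'x) letter list \<Rightarrow> ('t, 'x) letter list \<Rightarrow> bool" where
  "rf_equiv \<sigma> \<rho> \<longleftrightarrow>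
     (\<forall>t. thread_proj t \<sigma> = thread_proj t \<rho>) \<and>
     (\<forall>i < length \<sigma>. \<forall>i' < length \<rho>. event_id \<sigma> i = event_id \<rho> i' \<longrightarrow>
        map_option (event_id \<sigma>) (rf \<sigma> i) = map_option (event_id \<rho>) (rf \<rho> i'))"

text \<open>
  \<open>P n\<close> is the set of positions of \<open>\<sigma>\<close> forming the \<open>n\<close>-th slice. Comparing event names rather
  than letters makes \<open>\<rho>\<close> the concatenation of the slices as a sequence of events; equal
  names carry equal letters because the thread projections of \<open>\<sigma>\<close> and \<open>\<rho>\<close> agree.
\<close>

definition sliced_reordering ::
    "nat \<Rightarrow> ('t, 'x) letter list \<Rightarrow> ('t, 'x) letter list \<Rightarrow> bool" where
  "sliced_reordering k \<sigma> \<rho> \<longleftrightarrow>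
     rf_equiv \<sigma> \<rho> \<and>
     (\<exists>P :: nat \<Rightarrow> nat set.
        disjoint_family_on P {1..k+1} \<and>
        (\<Union>n\<in>{1..k+1}. P n) = {..<length \<sigma>} \<and>
        event_seq \<rho> = concat (map (\<lambda>n. nths (event_seq \<sigma>) (P n)) [1..<k+2]))"

definition pre_sliced ::
    "'t set \<Rightarrow> 'x set \<Rightarrow> nat \<Rightarrow> ('t, 'x) letter list set \<Rightarrow> ('t, 'x) letter list set" where
  "pre_sliced T X k L =
     {\<sigma> \<in> lists (alphabet T X). \<exists>\<rho>\<in>L. sliced_reordering k \<sigma> \<rho>}"

end

theory Submission imports Defs begin

text \<open>
  Annotate every letter of \<open>\<sigma>\<close> with the number of its slice. The annotation determines \<open>\<rho>\<close>,
  whose events are those of \<open>\<sigma>\<close> sorted by slice and then by position. It is legal iff slice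
  numbers never decrease along a thread, no read overtakes its source and no write to the same
  location moves in between;
  these conditions, as well as \<open>\<rho> \<in> L\<close>, only depend on a bounded summary of the annotated
  word that can be updated letter by letter. The legal annotated words are thus saturated by a
  right congruence of finite index, and the pre-image is their projection to the letters.
\<close>

section \<open>Regularity from right congruences of finite index\<close>

text \<open>One half of Myhill-Nerode: the values of \<open>h\<close> are the states of an
  automaton. \<open>cong\<close> makes its steps well defined and \<open>sat\<close> its acceptance;
  finiteness lets the values be coded as natural numbers.\<close>

lemma regular_langI:
  fixes h :: "'a list \<Rightarrow> 's"
  assumes fin: "finite (h ` lists A)"
    and cong: "\<And>u v a. u \<in> lists A \<Longrightarrow> v \<in> lists A \<Longrightarrow> a \<in> A \<Longrightarrow> h u = h v \<Longrightarrow> h (u @ [a]) = h (v @ [a])"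
    and sat: "\<And>u v. u \<in> lists A \<Longrightarrow> v \<in> lists A \<Longrightarrow> h u = h v \<Longrightarrow> u \<in> L \<Longrightarrow> v \<in> L"
    and sub: "L \<subseteq> lists A"
  shows "regular_lang A L"
proof -
  obtain f :: "'s \<Rightarrow> nat" where f: "inj_on f (h ` lists A)"
    using finite_imp_inj_to_nat_seg[OF fin] by blast
  define g where "g = f \<circ> h"
  have g_eq: "g u = g v \<longleftrightarrow> h u = h v" if "u \<in> lists A" "v \<in> lists A" for u v
    using f that by (auto simp: g_def inj_on_eq_iff)
  \<comment> \<open>A state is read back as some word with that code; by \<open>cong\<close> the
    choice does not matter.\<close>
  define \<delta> where "\<delta> q a = g ((SOME u. u \<in> lists A \<and> g u = q) @ [a])" for q a
  have step: "\<delta> (g u) a = g (u @ [a])" if "u \<in> lists A" "a \<in> A" for u a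
  proof -
    let ?v = "SOME v. v \<in> lists A \<and> g v = g u"
    have "?v \<in> lists A \<and> g ?v = g u"
      by (rule someI[of _ u]) (use that in simp)
    then have "h (?v @ [a]) = h (u @ [a])"
      using cong that g_eq by blast
    then show ?thesis by (simp add: \<delta>_def g_def)
  qed
  have run: "foldl \<delta> (g []) w = g w" if "w \<in> lists A" for w
    using that by (induction w rule: rev_induct) (auto simp: step)
  have acc: "g w \<in> g ` L \<longleftrightarrow> w \<in> L" if "w \<in> lists A" for w
  proof
    assume "g w \<in> g ` L"
    then obtain v where v: "v \<in> L" "g v = g w" by auto
    then have "v \<in> lists A" using sub by auto
    then show "w \<in> L" using sat[of v w] v that g_eq by simp
  qed simp
  show ?thesis
    unfolding regular_lang_def
  proof (intro exI conjI)
    show "finite (g ` lists A)"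
      using finite_imageI[OF fin, of f] by (simp add: g_def image_comp)
    show "g [] \<in> g ` lists A" by simp
    show "g ` L \<subseteq> g ` lists A" using sub by blast
    show "\<forall>q\<in>g ` lists A. \<forall>a\<in>A. \<delta> q a \<in> g ` lists A"
      by (auto simp: step)
    show "L = {w \<in> lists A. foldl \<delta> (g []) w \<in> g ` L}"
    proof -
      have "foldl \<delta> (g []) w \<in> g ` L \<longleftrightarrow> w \<in> L" if "w \<in> lists A" for w
        using acc run that by simp
      then show ?thesis using sub by blast
    qed
  qed
qed

text \<open>Subset construction: the projection forgets the second components, so the state after
  \<open>u\<close> is the set of \<open>h\<close>-values of all annotations of \<open>u\<close>, a
  subset of a finite set.\<close>

lemma regular_lang_map_fst:
  fixes h :: "('a \<times> 'b) list \<Rightarrow> 's"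
  assumes fin: "finite (h ` lists (A \<times> B))"
    and cong: "\<And>u v z. u \<in> lists (A \<times> B) \<Longrightarrow> v \<in> lists (A \<times> B) \<Longrightarrow> z \<in> A \<times> B \<Longrightarrow> h u = h v
      \<Longrightarrow> h (u @ [z]) = h (v @ [z])"
    and sat: "\<And>u v. u \<in> lists (A \<times> B) \<Longrightarrow> v \<in> lists (A \<times> B) \<Longrightarrow> h u = h v \<Longrightarrow> u \<in> M \<Longrightarrow> v \<in> M"
    and sub: "M \<subseteq> lists (A \<times> B)"
  shows "regular_lang A (map fst ` M)"
proof -
  define lifts where "lifts u = {w \<in> lists (A \<times> B). map fst w = u}" for u
  \<comment> \<open>Annotations of the longer word extend annotations of \<open>u\<close>, so
    \<open>cong\<close> can be applied to each member of the set of values separately.\<close>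
  have lifts_snoc: "lifts (u @ [a]) = {w @ [(a, b)] | w b. w \<in> lifts u \<and> b \<in> B}" if "a \<in> A" for u a
  proof (intro equalityI subsetI)
    fix w assume w: "w \<in> lifts (u @ [a])"
    then obtain w' z where "w = w' @ [z]" "map fst w' = u" "fst z = a"
      by (auto simp: lifts_def map_eq_append_conv)
    then show "w \<in> {w @ [(a, b)] | w b. w \<in> lifts u \<and> b \<in> B}"
      using w by (cases z) (auto simp: lifts_def)
  qed (use that in \<open>auto simp: lifts_def\<close>)
  have sub_lifts: "lifts u \<subseteq> lists (A \<times> B)" for u by (auto simp: lifts_def)
  show ?thesis
  proof (rule regular_langI[where h = "\<lambda>u. h ` lifts u"])
    have "(\<lambda>u. h ` lifts u) ` lists A \<subseteq> Pow (h ` lists (A \<times> B))"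
      using sub_lifts by blast
    then show "finite ((\<lambda>u. h ` lifts u) ` lists A)"
      using fin by (meson finite_Pow_iff finite_subset)
  next
    fix u v a assume a: "a \<in> A" and eq: "h ` lifts u = h ` lifts v"
    have "h ` lifts (u' @ [a]) \<subseteq> h ` lifts (v' @ [a])" if eq': "h ` lifts u' = h ` lifts v'" for u' v'
    proof
      fix s assume "s \<in> h ` lifts (u' @ [a])"
      then obtain w b where w: "w \<in> lifts u'" "b \<in> B" "s = h (w @ [(a, b)])"
        unfolding lifts_snoc[OF a] by blast
      then obtain w' where w': "w' \<in> lifts v'" "h w = h w'" using eq' by blast
      have "h (w @ [(a, b)]) = h (w' @ [(a, b)])"
        by (rule cong) (use w w' a in \<open>auto simp: lifts_def\<close>)
      moreover have "w' @ [(a, b)] \<in> lifts (v' @ [a])"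
        unfolding lifts_snoc[OF a] using w(2) w'(1) by blast
      ultimately show "s \<in> h ` lifts (v' @ [a])" using w(3) by simp
    qed
    from this[OF eq] this[OF eq[symmetric]]
    show "h ` lifts (u @ [a]) = h ` lifts (v @ [a])" by blast
  next
    fix u v assume eq: "h ` lifts u = h ` lifts v" and "u \<in> map fst ` M"
    then obtain w where w: "w \<in> M" "map fst w = u" by auto
    then have "w \<in> lifts u" using sub by (auto simp: lifts_def)
    then obtain w' where w': "w' \<in> lifts v" "h w = h w'" using eq by blast
    have "w' \<in> M" by (rule sat[of w w']) (use w w' sub in \<open>auto simp: lifts_def\<close>)
    then show "v \<in> map fst ` M" using w' by (auto simp: lifts_def)
  next
    show "map fst ` M \<subseteq> lists A" using sub by fastforce
  qed
qed

section \<open>Annotated words and their legality\<close>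

definition slice :: "('a \<times> nat) list \<Rightarrow> nat \<Rightarrow> 'a list" where
  "slice w n = map fst (filter (\<lambda>z. snd z = n) w)"

definition reord :: "nat \<Rightarrow> ('a \<times> nat) list \<Rightarrow> 'a list" where
  "reord k w = concat (map (slice w) [1..<k+2])"

text \<open>\<open>sorted_wrt\<close> compares all pairs, not just neighbours, since events of other
  threads may stand in between.\<close>

definition thread_mono :: "(('t, 'x) letter \<times> nat) list \<Rightarrow> bool" where
  "thread_mono w = sorted_wrt (\<lambda>y z. thread (fst y) = thread (fst z) \<longrightarrow> snd y \<le> snd z) w"

definition writes_to :: "'x \<Rightarrow> ('t, 'x) letter \<Rightarrow> bool" where
  "writes_to x a \<longleftrightarrow> kind a = Write \<and> loc a = x"

text \<open>The default 0 lies below the slice numbers, which start at 1, so a read without a source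
  behaves as if its source stood in front of all slices.\<close>

definition last_slice :: "(('t, 'x) letter \<times> nat) list \<Rightarrow> 'x \<Rightarrow> nat" where
  "last_slice w x =
     (let zs = filter (\<lambda>z. writes_to x (fst z)) w in if zs = [] then 0 else snd (last zs))"

text \<open>Positions are dropped: the location and the two slice numbers are bounded information,
  and they are all that a later write must be checked against.\<close>

definition reads :: "(('t, 'x) letter \<times> nat) list \<Rightarrow> ('x \<times> nat \<times> nat) set" where
  "reads w = {(loc (fst (w ! i)), last_slice (take i w) (loc (fst (w ! i))), snd (w ! i)) | i.
     i < length w \<and> kind (fst (w ! i)) = Read}"

text \<open>
  The read at position \<open>i\<close> lies in slice \<open>s\<close> and its source in slice \<open>p\<close>, where \<open>p = 0\<close> if it
  has no source; the slices are numbered from 1. The forbidden writes are exactly those that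
  \<open>\<rho>\<close> places after the source and before the read.
\<close>

definition read_ok :: "(('t, 'x) letter \<times> nat) list \<Rightarrow> nat \<Rightarrow> bool" where
  "read_ok w i \<longleftrightarrow> (let x = loc (fst (w ! i)); s = snd (w ! i); p = last_slice (take i w) x in
     p \<le> s \<and>
     (\<forall>m < length w. writes_to x (fst (w ! m)) \<longrightarrow>
       (m < i \<longrightarrow> \<not> (p < snd (w ! m) \<and> snd (w ! m) \<le> s)) \<and>
       (i < m \<longrightarrow> \<not> (p \<le> snd (w ! m) \<and> snd (w ! m) < s))))"

definition rf_ok :: "(('t, 'x) letter \<times> nat) list \<Rightarrow> bool" where
  "rf_ok w \<longleftrightarrow> (\<forall>i < length w. kind (fst (w ! i)) = Read \<longrightarrow> read_ok w i)"

section \<open>Updating the summary by one letter\<close>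

lemma slice_snoc: "slice (w @ [z]) n = slice w n @ (if snd z = n then [fst z] else [])"
  by (simp add: slice_def)

lemma thread_mono_snoc:
  "thread_mono (w @ [z]) \<longleftrightarrow>
     thread_mono w \<and> (\<forall>y\<in>set w. thread (fst y) = thread (fst z) \<longrightarrow> snd y \<le> snd z)"
  by (simp add: thread_mono_def sorted_wrt_append)

lemma last_slice_snoc:
  "last_slice (w @ [z]) x = (if writes_to x (fst z) then snd z else last_slice w x)"
  by (simp add: last_slice_def Let_def)

lemma reads_snoc:
  "reads (w @ [z]) = reads w \<union>
     (if kind (fst z) = Read then {(loc (fst z), last_slice w (loc (fst z)), snd z)} else {})"
proof -
  have "{i. i < length (w @ [z]) \<and> kind (fst ((w @ [z]) ! i)) = Read} =
      {i. i < length w \<and> kind (fst (w ! i)) = Read} \<union> (if kind (fst z) = Read then {length w} else {})"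
    by (auto simp: less_Suc_eq nth_append split: if_splits)
  then show ?thesis
    unfolding reads_def setcompr_eq_image by (simp add: image_Un nth_append cong: image_cong_simp)
qed

text \<open>Each pair of a read and a write is checked when the later of the two arrives: a new read
  against the writes in \<open>set w\<close>, a new write against the triples in
  \<open>reads w\<close>.\<close>

lemma rf_ok_snoc:
  "rf_ok (w @ [z]) \<longleftrightarrow> rf_ok w \<and>
     (if kind (fst z) = Read
      then let p = last_slice w (loc (fst z)) in p \<le> snd z \<and>
        (\<forall>y\<in>set w. writes_to (loc (fst z)) (fst y) \<longrightarrow> \<not> (p < snd y \<and> snd y \<le> snd z))
      else \<forall>(x, p, s)\<in>reads w. x = loc (fst z) \<longrightarrow> \<not> (p \<le> snd z \<and> snd z < s))"
proof -
  \<comment> \<open>The part of the word in front of an old read is unchanged, and so is its source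
    slice; only the clause for writes after the read gains an instance.\<close>
  have old: "read_ok (w @ [z]) i \<longleftrightarrow> read_ok w i \<and>
    (let x = loc (fst (w ! i)); p = last_slice (take i w) x in
      writes_to x (fst z) \<longrightarrow> \<not> (p \<le> snd z \<and> snd z < snd (w ! i)))" if "i < length w" for i
    using that unfolding read_ok_def Let_def by (auto simp: less_Suc_eq nth_append)
  have new: "read_ok (w @ [z]) (length w) \<longleftrightarrow>
     (let p = last_slice w (loc (fst z)) in p \<le> snd z \<and>
        (\<forall>y\<in>set w. writes_to (loc (fst z)) (fst y) \<longrightarrow> \<not> (p < snd y \<and> snd y \<le> snd z)))"
    unfolding read_ok_def Let_def all_set_conv_all_nth by (auto simp: less_Suc_eq nth_append)
  have "rf_ok (w @ [z]) \<longleftrightarrow> (\<forall>i<length w. kind (fst (w ! i)) = Read \<longrightarrow> read_ok (w @ [z]) i) \<and>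
      (kind (fst z) = Read \<longrightarrow> read_ok (w @ [z]) (length w))"
    unfolding rf_ok_def by (auto simp: less_Suc_eq nth_append)
  also have "\<dots> \<longleftrightarrow> rf_ok w \<and>
     (\<forall>(x, p, s)\<in>reads w. writes_to x (fst z) \<longrightarrow> \<not> (p \<le> snd z \<and> snd z < s)) \<and>
      (kind (fst z) = Read \<longrightarrow> read_ok (w @ [z]) (length w))"
    using old unfolding rf_ok_def reads_def Let_def by blast
  finally show ?thesis
    unfolding new by (cases "kind (fst z)") (auto simp: writes_to_def)
qed

text \<open>
  The state in which the run on \<open>\<rho>\<close> enters the \<open>n\<close>-th slice depends on the letters still to
  come, so the effect of each slice is recorded from every state.
\<close>

definition transitions ::
    "('q \<Rightarrow> 'a \<Rightarrow> 'q) \<Rightarrow> 'q set \<Rightarrow> nat set \<Rightarrow> ('a \<times> nat) list \<Rightarrow> (nat \<times> 'q \<times> 'q) set" where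
  "transitions \<delta> Q B w = {(n, q, foldl \<delta> q (slice w n)) | n q. n \<in> B \<and> q \<in> Q}"

text \<open>\<open>transitions\<close> is the graph of a function on pairs from \<open>B\<close> and
  \<open>Q\<close>, and graphs over the same domain are equal iff the functions agree
  pointwise.\<close>

lemma transitions_eq_iff:
  "transitions \<delta> Q B u = transitions \<delta> Q B v \<longleftrightarrow>
     (\<forall>n\<in>B. \<forall>q\<in>Q. foldl \<delta> q (slice u n) = foldl \<delta> q (slice v n))"
proof
  assume eq: "transitions \<delta> Q B u = transitions \<delta> Q B v"
  have "(n, q, foldl \<delta> q (slice u n)) \<in> transitions \<delta> Q B v" if "n \<in> B" "q \<in> Q" for n q
    unfolding eq[symmetric] using that by (auto simp: transitions_def)
  then show "\<forall>n\<in>B. \<forall>q\<in>Q. foldl \<delta> q (slice u n) = foldl \<delta> q (slice v n)"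
    unfolding transitions_def by blast
next
  assume "\<forall>n\<in>B. \<forall>q\<in>Q. foldl \<delta> q (slice u n) = foldl \<delta> q (slice v n)"
  then show "transitions \<delta> Q B u = transitions \<delta> Q B v"
    unfolding transitions_def by (intro Collect_cong) (metis (no_types, lifting))
qed

section \<open>Finiteness of the summary and regularity of the projection\<close>

lemma foldl_in_states:
  assumes "\<forall>q\<in>Q. \<forall>a\<in>A. \<delta> q a \<in> Q" "q \<in> Q" "w \<in> lists A"
  shows "foldl \<delta> q w \<in> Q"
  using assms(2,3) by (induction w arbitrary: q) (use assms(1) in auto)

lemma slice_in_lists: "w \<in> lists (A \<times> B) \<Longrightarrow> slice w n \<in> lists A"
  by (induction w) (auto simp: slice_def)

lemma last_slice_le:
  assumes "w \<in> lists (A \<times> {1..N})"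
  shows "last_slice w x \<le> N"
  using assms by (induction w rule: rev_induct) (auto simp: last_slice_snoc last_slice_def[of "[]"])

text \<open>The bound on the source slice has to admit 0, the default of
  \<open>last_slice\<close>.\<close>

lemma reads_subset:
  assumes "w \<in> lists (alphabet T X \<times> {1..N})"
  shows "reads w \<subseteq> X \<times> {..N} \<times> {..N}"
  using assms
proof (induction w rule: rev_induct)
  case (snoc z w)
  then show ?case
    using last_slice_le[of w "alphabet T X" N "loc (fst z)"]
    by (auto simp: reads_snoc alphabet_def)
qed (simp add: reads_def)

lemma finite_alphabet:
  assumes "finite T" "finite X"
  shows "finite (alphabet T X)"
proof -
  have kinds: "(UNIV :: op_kind set) = {Write, Read}"
    using op_kind.exhaust by auto
  have "alphabet T X = (\<lambda>(t, p, x). Letter t p x) ` (T \<times> UNIV \<times> X)"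
    unfolding alphabet_def by (auto simp: image_iff)
  then show ?thesis using assms by (simp add: kinds)
qed

lemma regular_annotated:
  fixes T :: "'t set" and X :: "'x set"
  assumes "finite T" "finite X" "regular_lang (alphabet T X) L"
  shows "regular_lang (alphabet T X)
    (map fst ` {w \<in> lists (alphabet T X \<times> {1..k+1}). thread_mono w \<and> rf_ok w \<and> reord k w \<in> L})"
proof -
  let ?A = "alphabet T X" and ?B = "{1..k+1}"
  obtain Q :: "nat set" and q0 F \<delta> where Q: "finite Q" "q0 \<in> Q" "\<forall>q\<in>Q. \<forall>a\<in>?A. \<delta> q a \<in> Q"
    and L: "L = {w \<in> lists ?A. foldl \<delta> q0 w \<in> F}"
    using assms(3) unfolding regular_lang_def by blast
  \<comment> \<open>The summary. \<open>set w\<close> decides whether a new letter keeps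
    \<open>thread_mono\<close> and, with the last slices, whether a new read is legal;
    \<open>reads w\<close> decides this for a new write; the transitions decide whether the
    reordered word is in \<open>L\<close>. The last slices are stored as a graph over
    \<open>X\<close>, so that they lie in a finite power set.\<close>
  define h where "h w = (set w, thread_mono w, rf_ok w, (\<lambda>x. (x, last_slice w x)) ` X, reads w,
    transitions \<delta> Q ?B w)" for w :: "(('t, 'x) letter \<times> nat) list"
  have slice: "slice w n \<in> lists ?A" if "w \<in> lists (?A \<times> ?B)" for w n
    using slice_in_lists[OF that] .
  show ?thesis
  proof (rule regular_lang_map_fst[where h = h])
    have "h w \<in> Pow (?A \<times> ?B) \<times> UNIV \<times> UNIV \<times> Pow (X \<times> {..k+1}) \<times> Pow (X \<times> {..k+1} \<times> {..k+1})
        \<times> Pow (?B \<times> Q \<times> Q)" if w: "w \<in> lists (?A \<times> ?B)" for w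
      using w last_slice_le[OF w] reads_subset[OF w] foldl_in_states[OF Q(3) _ slice[OF w]]
      unfolding h_def transitions_def by auto
    then have "h ` lists (?A \<times> ?B) \<subseteq> Pow (?A \<times> ?B) \<times> UNIV \<times> UNIV \<times> Pow (X \<times> {..k+1})
        \<times> Pow (X \<times> {..k+1} \<times> {..k+1}) \<times> Pow (?B \<times> Q \<times> Q)" by blast
    then show "finite (h ` lists (?A \<times> ?B))"
      by (rule finite_subset) (use assms Q finite_alphabet[of T X] in simp)
  next
    fix u v z
    assume u: "u \<in> lists (?A \<times> ?B)" and v: "v \<in> lists (?A \<times> ?B)" and z: "z \<in> ?A \<times> ?B"
      and eq: "h u = h v"
    have last: "last_slice u x = last_slice v x" if "x \<in> X" for x
      using eq that unfolding h_def by auto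
    have x: "loc (fst z) \<in> X" using z by (auto simp: alphabet_def)
    \<comment> \<open>Only the slice numbered \<open>snd z\<close> grows, by the same letter in both
      words.\<close>
    have trans: "transitions \<delta> Q ?B (u @ [z]) = transitions \<delta> Q ?B (v @ [z])"
      using eq unfolding h_def transitions_eq_iff prod.inject by (auto simp: slice_snoc)
    have lasts: "(\<lambda>x. (x, last_slice (u @ [z]) x)) ` X = (\<lambda>x. (x, last_slice (v @ [z]) x)) ` X"
      by (rule image_cong) (auto simp: last_slice_snoc last)
    have "reads u = reads v" "set u = set v" "rf_ok u = rf_ok v" "thread_mono u = thread_mono v"
      using eq unfolding h_def by auto
    then show "h (u @ [z]) = h (v @ [z])"
      unfolding h_def trans lasts by (simp add: thread_mono_snoc rf_ok_snoc reads_snoc last[OF x])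
  next
    fix u v
    assume u: "u \<in> lists (?A \<times> ?B)" and v: "v \<in> lists (?A \<times> ?B)" and eq: "h u = h v"
      and "u \<in> {w \<in> lists (?A \<times> ?B). thread_mono w \<and> rf_ok w \<and> reord k w \<in> L}"
    then have u': "thread_mono u" "rf_ok u" "reord k u \<in> L" by auto
    have steps: "foldl \<delta> q (slice u n) = foldl \<delta> q (slice v n)" if "n \<in> ?B" "q \<in> Q" for n q
      using eq that unfolding h_def prod.inject transitions_eq_iff by blast
    \<comment> \<open>The run on the reordered word chains the recorded effects. The start state is
      arbitrary in the induction because each slice starts where the previous one ended.\<close>
    have run: "foldl \<delta> q (concat (map (slice u) ns)) = foldl \<delta> q (concat (map (slice v) ns))"
      if "set ns \<subseteq> ?B" "q \<in> Q" for ns q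
      using that
    proof (induction ns arbitrary: q)
      case (Cons n ns)
      have "foldl \<delta> q (slice v n) \<in> Q"
        using foldl_in_states[OF Q(3) _ slice[OF v]] Cons.prems by blast
      then show ?case using Cons steps[of n q] by simp
    qed simp
    have "foldl \<delta> q0 (reord k v) = foldl \<delta> q0 (reord k u)"
      unfolding reord_def by (rule run[symmetric]) (use Q in auto)
    moreover have "reord k v \<in> lists ?A"
      using slice[OF v] unfolding reord_def by (force simp: in_lists_conv_set)
    ultimately show "v \<in> {w \<in> lists (?A \<times> ?B). thread_mono w \<and> rf_ok w \<and> reord k w \<in> L}"
      using u' v eq unfolding h_def L by auto
  qed blast
qed


section \<open>Sources, event names and source slices\<close>

lemma rf_eq_Some_iff:
  "rf \<sigma> i = Some j \<longleftrightarrow> i < length \<sigma> \<and> kind (\<sigma> ! i) = Read \<and> j < i \<and>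
     writes_to (loc (\<sigma> ! i)) (\<sigma> ! j) \<and> (\<forall>m<i. writes_to (loc (\<sigma> ! i)) (\<sigma> ! m) \<longrightarrow> m \<le> j)"
proof -
  have eq: "writes_before \<sigma> i = {m. m < i \<and> writes_to (loc (\<sigma> ! i)) (\<sigma> ! m)}"
    by (auto simp: writes_before_def writes_to_def)
  have fin: "finite (writes_before \<sigma> i)" unfolding eq by simp
  have "rf \<sigma> i = Some j \<longleftrightarrow> i < length \<sigma> \<and> kind (\<sigma> ! i) = Read \<and> j \<in> writes_before \<sigma> i \<and>
      (\<forall>m\<in>writes_before \<sigma> i. m \<le> j)"
    using Max_eq_iff[OF fin] Max_in[OF fin] Max_ge[OF fin] unfolding rf_def by auto
  then show ?thesis unfolding eq by blast
qed

lemma rf_eq_None_iff: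
  assumes "i < length \<sigma>" "kind (\<sigma> ! i) = Read"
  shows "rf \<sigma> i = None \<longleftrightarrow> (\<forall>m<i. \<not> writes_to (loc (\<sigma> ! i)) (\<sigma> ! m))"
  using assms by (auto simp: rf_def writes_before_def writes_to_def)

lemma rf_eq_None: "kind (\<sigma> ! i) \<noteq> Read \<Longrightarrow> rf \<sigma> i = None"
  by (simp add: rf_def)

text \<open>The predecessors of \<open>i\<close> in its thread also precede \<open>j\<close>, and so
  does \<open>i\<close> itself, which makes the count strictly larger.\<close>

lemma event_id_less:
  assumes "i < j" "thread (\<sigma> ! i) = thread (\<sigma> ! j)"
  shows "snd (event_id \<sigma> i) < snd (event_id \<sigma> j)"
  unfolding event_id_def snd_conv
  by (rule psubset_card_mono) (use assms in auto)

lemma event_id_inj: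
  assumes "event_id \<sigma> i = event_id \<sigma> j"
  shows "i = j"
proof -
  have "thread (\<sigma> ! i) = thread (\<sigma> ! j)" using assms by (simp add: event_id_def)
  then show ?thesis
    using event_id_less[of i j \<sigma>] event_id_less[of j i \<sigma>] assms by (cases i j rule: linorder_cases) auto
qed

text \<open>The index \<open>j\<close> counts the letters of \<open>t\<close> in
  \<open>take i \<sigma>\<close>, hence is the place of the event in the projection. A name thus
  determines its letter once the projections are known.\<close>

lemma thread_proj_event_id:
  assumes "i < length \<sigma>" "event_id \<sigma> i = (t, j)"
  shows "thread_proj t \<sigma> ! j = \<sigma> ! i"
proof -
  have "card {m. m < i \<and> thread (\<sigma> ! m) = t} = length (filter (\<lambda>a. thread a = t) (take i \<sigma>))"
    using assms(1) by (auto simp: length_filter_conv_card intro!: arg_cong[where f = card])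
  then have j: "j = length (filter (\<lambda>a. thread a = t) (take i \<sigma>))" and t: "thread (\<sigma> ! i) = t"
    using assms(2) by (auto simp: event_id_def)
  have "thread_proj t \<sigma> = filter (\<lambda>a. thread a = t) (take i \<sigma> @ \<sigma> ! i # drop (Suc i) \<sigma>)"
    using id_take_nth_drop[OF assms(1)] unfolding thread_proj_def by metis
  then show ?thesis using j t by (simp add: nth_append)
qed

lemma nths_event_seq:
  "nths (event_seq \<sigma>) I = map (event_id \<sigma>) (filter (\<lambda>i. i \<in> I) [0..<length \<sigma>])"
proof -
  have "nths [0..<n] I = filter (\<lambda>i. i \<in> I) [0..<n]" for n
    by (induction n) (auto simp: nths_append)
  then show ?thesis by (simp add: event_seq_def nths_map)
qed

text \<open>The hypotheses express that \<open>j\<close> is the source of a read of \<open>x\<close>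
  at \<open>i\<close>; this connects \<open>last_slice\<close> with \<open>rf\<close>.\<close>

lemma last_slice_take:
  assumes "j < i" "i \<le> length w" "writes_to x (fst (w ! j))"
    "\<forall>m<i. writes_to x (fst (w ! m)) \<longrightarrow> m \<le> j"
  shows "last_slice (take i w) x = snd (w ! j)"
  using assms
proof (induction i)
  case (Suc i)
  then show ?case
    by (cases "j = i") (force simp: take_Suc_conv_app_nth last_slice_snoc)+
qed simp

lemma last_slice_take_eq_0:
  assumes "i \<le> length w" "\<forall>m<i. \<not> writes_to x (fst (w ! m))"
  shows "last_slice (take i w) x = 0"
proof -
  have "filter (\<lambda>z. writes_to x (fst z)) (take i w) = []"
    unfolding filter_empty_conv
  proof
    fix z assume "z \<in> set (take i w)"
    then obtain m where "m < i" "z = w ! m" by (auto simp: in_set_conv_nth)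
    then show "\<not> writes_to x (fst z)" using assms(2) by simp
  qed
  then show ?thesis by (simp add: last_slice_def)
qed

section \<open>The reordering as a permutation of positions\<close>

locale slicing =
  fixes w :: "(('t, 'x) letter \<times> nat) list" and k :: nat
  assumes slices: "snd ` set w \<subseteq> {1..k+1}"
begin

abbreviation "\<sigma> \<equiv> map fst w"
abbreviation "N \<equiv> length w"
abbreviation "c i \<equiv> snd (w ! i)"

text \<open>The lexicographic order on pairs of slice number and position.\<close>

definition before :: "nat \<Rightarrow> nat \<Rightarrow> bool" where
  "before i j \<longleftrightarrow> c i < c j \<or> c i = c j \<and> i < j"

text \<open>The sorting permutation: \<open>order ! r\<close> is the position in \<sigma> from which
  the letter at position \<open>r\<close> of \<open>reord k w\<close> is taken.\<close>

definition order :: "nat list" where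
  "order = concat (map (\<lambda>s. filter (\<lambda>i. c i = s) [0..<N]) [1..<k+2])"

lemma reord_eq: "reord k w = map (\<lambda>i. \<sigma> ! i) order"
proof -
  have "slice w s = map (\<lambda>i. fst (w ! i)) (filter (\<lambda>i. c i = s) [0..<N])" for s
  proof -
    have "slice w s = slice (map (\<lambda>i. w ! i) [0..<N]) s" by (simp add: map_nth)
    also have "\<dots> = map (\<lambda>i. fst (w ! i)) (filter (\<lambda>i. c i = s) [0..<N])"
      unfolding slice_def filter_map by (simp add: comp_def)
    finally show ?thesis .
  qed
  then have "reord k w = map (\<lambda>i. fst (w ! i)) order"
    unfolding reord_def order_def map_concat map_map comp_def
    by (intro arg_cong[where f = concat] map_cong refl)
  also have "\<dots> = map (\<lambda>i. \<sigma> ! i) order" unfolding order_def by auto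
  finally show ?thesis .
qed

lemma set_order: "set order = {..<N}"
proof -
  have "c i \<in> {1..k+1}" if "i < N" for i using slices that by (meson image_subset_iff nth_mem)
  then show ?thesis unfolding order_def by force
qed

lemma sorted_order: "sorted_wrt before order"
proof -
  \<comment> \<open>Generalised to any strictly increasing list of slice numbers for the
    induction.\<close>
  have "sorted_wrt before (concat (map (\<lambda>s. filter (\<lambda>i. c i = s) [0..<N]) ss))"
    if "sorted_wrt (<) ss" for ss
    using that
  proof (induction ss)
    case (Cons s ss)
    have "sorted_wrt (<) (filter (\<lambda>i. c i = s) [0..<N])"
      by (rule sorted_wrt_filter) simp
    then have "sorted_wrt before (filter (\<lambda>i. c i = s) [0..<N])"
      by (rule sorted_wrt_mono_rel[rotated]) (auto simp: before_def)
    moreover have "sorted_wrt before (concat (map (\<lambda>s. filter (\<lambda>i. c i = s) [0..<N]) ss))"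
      using Cons by simp
    ultimately show ?case using Cons.prems by (auto simp: sorted_wrt_append) (auto simp: before_def)
  qed simp
  then show ?thesis unfolding order_def by (meson sorted_wrt_upt)
qed

lemma nth_order_before: "r < r' \<Longrightarrow> r' < length order \<Longrightarrow> before (order ! r) (order ! r')"
  using sorted_wrt_nth_less[OF sorted_order] .

text \<open>A list sorted by the irreflexive relation \<open>before\<close> has no repetitions. With
  \<open>set_order\<close> this makes \<open>order\<close> a permutation of the positions.\<close>

lemma distinct_order: "distinct order"
  unfolding distinct_conv_nth
proof (intro allI impI)
  fix r r' assume "r < length order" "r' < length order" "r \<noteq> r'"
  then have "before (order ! r) (order ! r') \<or> before (order ! r') (order ! r)"
    using nth_order_before linorder_neq_iff by blast
  then show "order ! r \<noteq> order ! r'" by (auto simp: before_def)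
qed

lemma length_order: "length order = N"
  using distinct_card[OF distinct_order] set_order by simp

lemma order_less: "r < N \<Longrightarrow> order ! r < N"
  using set_order length_order nth_mem by (metis lessThan_iff)

lemma ex_order: "i < N \<Longrightarrow> \<exists>r<N. order ! r = i"
  using set_order length_order by (metis in_set_conv_nth lessThan_iff)

lemma nth_order_before_iff:
  assumes "r < N" "r' < N"
  shows "before (order ! r) (order ! r') \<longleftrightarrow> r < r'"
proof -
  consider "r < r'" | "r = r'" | "r' < r" by linarith
  then show ?thesis
  proof cases
    case 3
    then have "before (order ! r') (order ! r)" using nth_order_before assms length_order by simp
    with 3 show ?thesis by (auto simp: before_def)
  qed (use nth_order_before assms length_order in \<open>auto simp: before_def\<close>)
qed

lemma all_order_iff: "(\<forall>r<N. P (order ! r)) \<longleftrightarrow> (\<forall>i<N. P i)"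
  using order_less ex_order by blast

text \<open>Turns conditions on a prefix of the reordered word, such as those defining a source,
  into conditions on positions of \<sigma>.\<close>

lemma all_before_iff:
  assumes "r < N"
  shows "(\<forall>m<r. P (order ! m)) \<longleftrightarrow> (\<forall>i<N. before i (order ! r) \<longrightarrow> P i)"
proof -
  have "(\<forall>i<N. before i (order ! r) \<longrightarrow> P i) \<longleftrightarrow> (\<forall>m<N. before (order ! m) (order ! r) \<longrightarrow> P (order ! m))"
    using all_order_iff[of "\<lambda>i. before i (order ! r) \<longrightarrow> P i"] by simp
  also have "\<dots> \<longleftrightarrow> (\<forall>m<r. P (order ! m))"
    using assms nth_order_before_iff by (meson less_trans)
  finally show ?thesis by simp
qed

section \<open>Program order under the reordering\<close>

lemma thread_mono_iff:
  "thread_mono w \<longleftrightarrow> (\<forall>i j. i < j \<longrightarrow> j < N \<longrightarrow> thread (\<sigma> ! i) = thread (\<sigma> ! j) \<longrightarrow> c i \<le> c j)"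
  unfolding thread_mono_def sorted_wrt_iff_nth_less by simp

text \<open>Along a thread slice numbers never decrease, and ties are broken by position, so sorting
  moves no event past another one of its thread.\<close>

lemma before_iff_less:
  assumes "thread_mono w" "i < N" "j < N" "thread (\<sigma> ! i) = thread (\<sigma> ! j)"
  shows "before i j \<longleftrightarrow> i < j"
proof -
  have le: "c i \<le> c j" if "i < j" "j < N" "thread (\<sigma> ! i) = thread (\<sigma> ! j)" for i j
    using assms(1) that unfolding thread_mono_iff by blast
  consider "i < j" | "i = j" | "j < i" by linarith
  then show ?thesis
    by cases (use le[of i j] le[of j i] assms(2-4) in \<open>auto simp: before_def\<close>)
qed

text \<open>\<open>order\<close> maps the predecessors in the same thread bijectively onto those in
  \<sigma>, so the two counts agree.\<close>

lemma event_id_reord: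
  assumes mono: "thread_mono w" and r: "r < N"
  shows "event_id (reord k w) r = event_id \<sigma> (order ! r)"
proof -
  let ?t = "thread (\<sigma> ! (order ! r))"
  have nth: "reord k w ! m = \<sigma> ! (order ! m)" if "m < N" for m
    using that by (simp add: reord_eq length_order)
  let ?R = "{m. m < r \<and> thread (reord k w ! m) = ?t}"
  let ?S = "{i. i < order ! r \<and> thread (\<sigma> ! i) = ?t}"
  have "(!) order ` ?R = ?S"
  proof (intro equalityI subsetI)
    fix i assume "i \<in> (!) order ` ?R"
    then obtain m where m: "m < r" "thread (reord k w ! m) = ?t" "i = order ! m" by auto
    then have "thread (\<sigma> ! i) = ?t" using nth r by simp
    moreover have "before i (order ! r)" using m r nth_order_before_iff by simp
    ultimately show "i \<in> ?S"
      using before_iff_less[OF mono, of i "order ! r"] m r order_less by simp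
  next
    fix i assume i: "i \<in> ?S"
    then have iN: "i < N" using order_less[OF r] by simp
    then obtain m where m: "m < N" "order ! m = i" using ex_order by blast
    have "before i (order ! r)"
      using before_iff_less[OF mono iN order_less[OF r]] i by simp
    then have "m < r" using nth_order_before_iff m r by blast
    then show "i \<in> (!) order ` ?R" using i m nth by auto
  qed
  moreover have "card ((!) order ` ?R) = card ?R"
    by (intro card_image inj_on_nth[OF distinct_order]) (use r length_order in auto)
  ultimately have "card ?R = card ?S" by simp
  then show ?thesis using nth[OF r] by (simp add: event_id_def)
qed

lemma length_reord: "length (reord k w) = N"
  by (simp add: reord_eq length_order)

lemma event_seq_reord:
  assumes "thread_mono w"
  shows "event_seq (reord k w) = map (event_id \<sigma>) order"
  by (rule nth_equalityI)
    (auto simp: event_seq_def length_reord length_order event_id_reord[OF assms])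

text \<open>The positions of thread \<open>t\<close>, listed along \<open>order\<close> or along
  \<sigma>, form strictly increasing lists with the same elements, hence the same list.\<close>

lemma thread_proj_reord:
  assumes "thread_mono w"
  shows "thread_proj t (reord k w) = thread_proj t \<sigma>"
proof -
  let ?p = "\<lambda>i. thread (\<sigma> ! i) = t"
  have less: "sorted_wrt (<) (filter ?p order)"
  proof (rule sorted_wrt_mono_rel)
    show "sorted_wrt before (filter ?p order)" by (rule sorted_wrt_filter[OF sorted_order])
  qed (use before_iff_less[OF assms] set_order in auto)
  moreover have "sorted_wrt (<) (filter ?p [0..<N])" by (rule sorted_wrt_filter) simp
  ultimately have eq: "filter ?p order = filter ?p [0..<N]"
    by (intro sorted_distinct_set_unique) (use set_order in \<open>auto simp: strict_sorted_iff\<close>)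
  have "thread_proj t (reord k w) = map ((!) \<sigma>) (filter ?p order)"
    unfolding thread_proj_def reord_eq filter_map by (simp add: comp_def)
  also have "\<dots> = filter (\<lambda>a. thread a = t) (map ((!) \<sigma>) [0..<N])"
    unfolding eq filter_map by (simp add: comp_def)
  also have "map ((!) \<sigma>) [0..<N] = \<sigma>" using map_nth[of \<sigma>] by simp
  finally show ?thesis by (simp add: thread_proj_def)
qed

section \<open>Reads-from under the reordering\<close>

text \<open>Being the last earlier write in the reordered word is a statement about
  \<open>before\<close>. Relative to the source in \<sigma>, \<open>before\<close> unfolds to
  comparisons of slice numbers, which are the inequalities of \<open>read_ok\<close>.\<close>

lemma rf_reord_iff:
  assumes r: "r < N" and read: "kind (\<sigma> ! (order ! r)) = Read"
  shows "map_option ((!) order) (rf (reord k w) r) = rf \<sigma> (order ! r) \<longleftrightarrow> read_ok w (order ! r)"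
proof -
  define i where "i = order ! r"
  define W where "W m \<longleftrightarrow> writes_to (loc (\<sigma> ! i)) (\<sigma> ! m)" for m
  have i: "i < N" using order_less[OF r] by (simp add: i_def)
  have notW: "\<not> W i" using read by (simp add: W_def writes_to_def i_def)
  have nth: "reord k w ! m = \<sigma> ! (order ! m)" if "m < N" for m
    using that by (simp add: reord_eq length_order)
  have W: "writes_to (loc (fst (w ! i))) (fst (w ! m)) \<longleftrightarrow> W m" if "m < N" for m
    using that i by (simp add: W_def)
  have Wr: "writes_to (loc (reord k w ! r)) (reord k w ! m) \<longleftrightarrow> W (order ! m)" if "m < N" for m
    using that nth r by (simp add: W_def i_def)
  have ok: "read_ok w i \<longleftrightarrow> (let p = last_slice (take i w) (loc (fst (w ! i))) in p \<le> c i \<and>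
     (\<forall>m < N. W m \<longrightarrow> (m < i \<longrightarrow> \<not> (p < c m \<and> c m \<le> c i)) \<and>
       (i < m \<longrightarrow> \<not> (p \<le> c m \<and> c m < c i))))"
    unfolding read_ok_def Let_def by (simp add: W cong: conj_cong)
  have reads: "kind (reord k w ! r) = Read" using read nth r by simp
  show ?thesis
  proof (cases "rf \<sigma> i")
    case None
    then have none: "\<forall>m<i. \<not> W m"
      using rf_eq_None_iff[of i \<sigma>] i read by (simp add: W_def i_def)
    then have p: "last_slice (take i w) (loc (fst (w ! i))) = 0"
      by (intro last_slice_take_eq_0) (use i W in auto)
    have "rf (reord k w) r = None \<longleftrightarrow> (\<forall>m<r. \<not> W (order ! m))"
      using rf_eq_None_iff[OF _ reads] r Wr by (simp add: length_reord)
    also have "\<dots> \<longleftrightarrow> (\<forall>m<N. before m i \<longrightarrow> \<not> W m)"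
      using all_before_iff[OF r, of "\<lambda>m. \<not> W m"] by (simp add: i_def)
    also have "\<dots> \<longleftrightarrow> (\<forall>m<N. W m \<longrightarrow> i < m \<longrightarrow> \<not> c m < c i)"
    proof -
      \<comment> \<open>All writes to the location lie after \<open>i\<close>, so only a smaller
        slice number can put one of them in front of the read.\<close>
      have "before m i \<longleftrightarrow> i < m \<and> c m < c i" if "W m" for m
        using none notW that by (cases m i rule: linorder_cases) (auto simp: before_def)
      then show ?thesis by blast
    qed
    \<comment> \<open>With source slice 0 the lower bounds hold trivially, and there are no earlier
      writes to check.\<close>
    also have "\<dots> \<longleftrightarrow> read_ok w i"
      unfolding ok p Let_def using none by auto
    finally show ?thesis using None by (simp add: i_def)
  next
    case (Some j)
    then have j: "j < i" "W j" and last: "\<forall>m<i. W m \<longrightarrow> m \<le> j"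
      by (auto simp: rf_eq_Some_iff W_def)
    then have p: "last_slice (take i w) (loc (fst (w ! i))) = c j"
      by (intro last_slice_take) (use i W in auto)
    obtain q where q: "q < N" "order ! q = j" using ex_order[of j] j i by auto
    have inj: "order ! m = j \<longleftrightarrow> m = q" if "m < N" for m
      using nth_eq_iff_index_eq[OF distinct_order, of m q] that q length_order by simp
    have "map_option ((!) order) (rf (reord k w) r) = Some j \<longleftrightarrow> rf (reord k w) r = Some q"
    proof -
      have "m < N" if "rf (reord k w) r = Some m" for m
        using that r by (simp add: rf_eq_Some_iff)
      then show ?thesis using inj q by (cases "rf (reord k w) r") auto
    qed
    also have "\<dots> \<longleftrightarrow> q < r \<and> W j \<and> (\<forall>m<r. W (order ! m) \<longrightarrow> m \<le> q)"
    proof -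
      have "writes_to (loc (reord k w ! r)) (reord k w ! m) \<longleftrightarrow> W (order ! m)" if "m < r" for m
        using Wr that r by simp
      then show ?thesis
        using r reads q unfolding rf_eq_Some_iff length_reord by auto
    qed
    also have "\<dots> \<longleftrightarrow> before j i \<and> (\<forall>m<N. W m \<longrightarrow> before m i \<longrightarrow> \<not> before j m)"
    proof -
      have "q < r \<longleftrightarrow> before j i"
        using nth_order_before_iff[of q r] q r by (simp add: i_def)
      moreover have "m \<le> q \<longleftrightarrow> \<not> before j (order ! m)" if "m < r" for m
        using nth_order_before_iff[of q m] q r that by auto
      ultimately show ?thesis
        using all_before_iff[OF r, of "\<lambda>m. W m \<longrightarrow> \<not> before j m"] j by (auto simp: i_def)
    qed
    also have "\<dots> \<longleftrightarrow> read_ok w i"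
    proof -
      have "before j i \<longleftrightarrow> c j \<le> c i" using j by (auto simp: before_def)
      \<comment> \<open>As \<open>j\<close> is the last write before \<open>i\<close>, every other
        write is in front of \<open>j\<close> or after \<open>i\<close>. The relative positions then
        settle all ties in \<open>before\<close>, which decides where the inequalities are
        strict.\<close>
      moreover have "(before m i \<longrightarrow> \<not> before j m) \<longleftrightarrow> (m < i \<longrightarrow> \<not> (c j < c m \<and> c m \<le> c i)) \<and>
         (i < m \<longrightarrow> \<not> (c j \<le> c m \<and> c m < c i))" if "W m" for m
      proof -
        have "m \<noteq> i" using notW that by auto
        then have "m < i \<and> m \<le> j \<or> i < m \<and> j < m"
          using last that j(1) by (cases "m < i") auto
        then show ?thesis by (elim disjE conjE) (auto simp: before_def)
      qed
      ultimately show ?thesis unfolding ok p Let_def by blast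
    qed
    finally show ?thesis using Some by (simp add: i_def)
  qed
qed

text \<open>The projections agree by \<open>thread_proj_reord\<close>. Event names are injective and
  translate along \<open>order\<close>, so comparing named sources amounts to comparing positions in
  \<sigma>.\<close>

lemma rf_equiv_reord_iff:
  assumes mono: "thread_mono w"
  shows "rf_equiv \<sigma> (reord k w) \<longleftrightarrow> rf_ok w"
proof -
  let ?\<rho> = "reord k w"
  have id: "event_id ?\<rho> r = event_id \<sigma> (order ! r)" if "r < N" for r
    using event_id_reord[OF mono that] .
  have opt: "map_option (event_id ?\<rho>) (rf ?\<rho> r) = map_option (event_id \<sigma>) (map_option ((!) order) (rf ?\<rho> r))"
    if "r < N" for r
  proof (cases "rf ?\<rho> r")
    case (Some m)
    then have "m < N" using that by (simp add: rf_eq_Some_iff)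
    then show ?thesis using Some id[of m] by simp
  qed simp
  have inj: "inj (event_id \<sigma>)" using event_id_inj by (blast intro: injI)
  have "rf_equiv \<sigma> ?\<rho> \<longleftrightarrow> (\<forall>r<N. map_option (event_id \<sigma>) (rf \<sigma> (order ! r)) =
      map_option (event_id ?\<rho>) (rf ?\<rho> r))"
    unfolding rf_equiv_def using thread_proj_reord[OF mono] id event_id_inj[of \<sigma>] order_less
    by (simp add: length_reord) (metis length_map)
  also have "\<dots> \<longleftrightarrow> (\<forall>r<N. rf \<sigma> (order ! r) = map_option ((!) order) (rf ?\<rho> r))"
    using opt inj_eq[OF option.inj_map[OF inj]] by presburger
  also have "\<dots> \<longleftrightarrow> (\<forall>r<N. kind (\<sigma> ! (order ! r)) = Read \<longrightarrow> read_ok w (order ! r))"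
  proof -
    \<comment> \<open>At an event that is not a read both maps are undefined, so only reads impose a
      condition.\<close>
    have "rf \<sigma> (order ! r) = map_option ((!) order) (rf ?\<rho> r)"
      if "r < N" "kind (\<sigma> ! (order ! r)) \<noteq> Read" for r
    proof -
      have "kind (?\<rho> ! r) \<noteq> Read" using that by (simp add: reord_eq length_order)
      then show ?thesis using that(2) rf_eq_None by (metis option.map(1))
    qed
    then show ?thesis using rf_reord_iff by metis
  qed
  also have "\<dots> \<longleftrightarrow> rf_ok w"
    using all_order_iff[of "\<lambda>i. kind (\<sigma> ! i) = Read \<longrightarrow> read_ok w i"] by (simp add: rf_ok_def)
  finally show ?thesis .
qed

section \<open>Sliced reorderings as legal annotations\<close>

text \<open>A sequence of event names fixes \<rho>, since the common projections supply the letters.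
  Indices increase along a thread in both runs, which forces \<open>thread_mono\<close>.\<close>

lemma eq_reord:
  assumes proj: "\<And>t. thread_proj t \<sigma> = thread_proj t \<rho>"
    and seq: "event_seq \<rho> = map (event_id \<sigma>) order"
  shows "thread_mono w \<and> \<rho> = reord k w"
proof -
  have len: "length \<rho> = N"
    using arg_cong[OF seq, of length] by (simp add: event_seq_def length_order)
  have id: "event_id \<rho> r = event_id \<sigma> (order ! r)" if "r < N" for r
    using arg_cong[OF seq, of "\<lambda>es. es ! r"] that by (simp add: event_seq_def len length_order)
  have nth: "\<rho> ! r = \<sigma> ! (order ! r)" if r: "r < N" for r
  proof -
    obtain t j where tj: "event_id \<rho> r = (t, j)" by fastforce
    then have "thread_proj t \<rho> ! j = \<rho> ! r" using thread_proj_event_id r len by metis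
    moreover have "thread_proj t \<sigma> ! j = \<sigma> ! (order ! r)"
      using thread_proj_event_id[of "order ! r" \<sigma>] order_less[OF r] tj id[OF r] by simp
    ultimately show ?thesis using proj by simp
  qed
  have "thread_mono w"
    unfolding thread_mono_iff
  proof (intro allI impI)
    fix i j assume ij: "i < j" "j < N" "thread (\<sigma> ! i) = thread (\<sigma> ! j)"
    obtain r where r: "r < N" "order ! r = i" using ex_order ij by (metis less_trans)
    obtain s where s: "s < N" "order ! s = j" using ex_order ij by metis
    \<comment> \<open>Otherwise the later event of the thread would come first in \<rho> and have
      the smaller index there, although events keep their names.\<close>
    have "\<not> s < r"
    proof
      assume "s < r"
      then have "snd (event_id \<rho> s) < snd (event_id \<rho> r)"
        by (rule event_id_less) (use nth r s ij in simp)
      then show False using event_id_less[OF ij(1,3)] id r s by simp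
    qed
    moreover have "r \<noteq> s" using r s ij(1) by auto
    ultimately have "before i j" using nth_order_before_iff[OF r(1) s(1)] r s by auto
    then show "c i \<le> c j" by (auto simp: before_def)
  qed
  moreover have "\<rho> = reord k w"
    by (rule nth_equalityI) (auto simp: len length_reord reord_eq length_order nth)
  ultimately show ?thesis ..
qed

end

text \<open>Partitions into slices and annotations are the same data: an annotation names the block
  of each position, and the blocks are its level sets.\<close>

lemma sliced_reordering_iff:
  "sliced_reordering k \<sigma> \<rho> \<longleftrightarrow>
     (\<exists>w. map fst w = \<sigma> \<and> snd ` set w \<subseteq> {1..k+1} \<and> thread_mono w \<and> rf_ok w \<and> \<rho> = reord k w)"
proof
  assume sr: "sliced_reordering k \<sigma> \<rho>"
  then obtain P :: "nat \<Rightarrow> nat set" where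
    dis: "disjoint_family_on P {1..k+1}" and un: "(\<Union>n\<in>{1..k+1}. P n) = {..<length \<sigma>}"
    and seq: "event_seq \<rho> = concat (map (\<lambda>n. nths (event_seq \<sigma>) (P n)) [1..<k+2])"
    and equiv: "rf_equiv \<sigma> \<rho>"
    unfolding sliced_reordering_def by blast
  \<comment> \<open>A block containing \<open>i\<close> exists by covering; disjointness makes it
    unique.\<close>
  define c where "c i = (SOME n. n \<in> {1..k+1} \<and> i \<in> P n)" for i
  have c: "c i \<in> {1..k+1} \<and> i \<in> P (c i)" if "i < length \<sigma>" for i
  proof -
    have "\<exists>n. n \<in> {1..k+1} \<and> i \<in> P n" using un that by blast
    then show ?thesis unfolding c_def by (rule someI_ex)
  qed
  have c_eq: "i \<in> P n \<longleftrightarrow> c i = n" if "i < length \<sigma>" "n \<in> {1..k+1}" for i n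
    using c[OF that(1)] that(2) dis unfolding disjoint_family_on_def by blast
  define w where "w = zip \<sigma> (map c [0..<length \<sigma>])"
  have len: "length w = length \<sigma>" and fst_w: "map fst w = \<sigma>" by (simp_all add: w_def)
  have snd_w: "snd (w ! i) = c i" if "i < length \<sigma>" for i using that by (simp add: w_def)
  have sl: "snd ` set w \<subseteq> {1..k+1}"
  proof
    fix n assume "n \<in> snd ` set w"
    then obtain i where "i < length \<sigma>" "n = snd (w ! i)" using len by (auto simp: in_set_conv_nth)
    then show "n \<in> {1..k+1}" using c snd_w by simp
  qed
  then interpret slicing w k by unfold_locales
  have "nths (event_seq \<sigma>) (P n) = map (event_id \<sigma>) (filter (\<lambda>i. snd (w ! i) = n) [0..<length w])"
    if "n \<in> {1..k+1}" for n
    unfolding nths_event_seq len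
    by (intro arg_cong[where f = "map _"] filter_cong refl) (use c_eq snd_w that in auto)
  then have "event_seq \<rho> = map (event_id \<sigma>) order"
    unfolding seq order_def map_concat map_map
    by (intro arg_cong[where f = concat] map_cong refl) auto
  then have "thread_mono w \<and> \<rho> = reord k w"
    using eq_reord equiv unfolding fst_w rf_equiv_def by blast
  then show "\<exists>w. map fst w = \<sigma> \<and> snd ` set w \<subseteq> {1..k+1} \<and> thread_mono w \<and> rf_ok w \<and> \<rho> = reord k w"
    using rf_equiv_reord_iff equiv sl fst_w by blast
next
  assume "\<exists>w. map fst w = \<sigma> \<and> snd ` set w \<subseteq> {1..k+1} \<and> thread_mono w \<and> rf_ok w \<and> \<rho> = reord k w"
  then obtain w where w: "map fst w = \<sigma>" "snd ` set w \<subseteq> {1..k+1}" "thread_mono w" "rf_ok w"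
    "\<rho> = reord k w" by blast
  then interpret slicing w k by unfold_locales
  have len: "length w = length \<sigma>" using w(1) by auto
  define P where "P n = {i. i < length w \<and> snd (w ! i) = n}" for n
  have "disjoint_family_on P {1..k+1}" by (auto simp: disjoint_family_on_def P_def)
  moreover have "(\<Union>n\<in>{1..k+1}. P n) = {..<length \<sigma>}"
    using w(2) len by (force simp: P_def)
  moreover have "event_seq \<rho> = concat (map (\<lambda>n. nths (event_seq \<sigma>) (P n)) [1..<k+2])"
  proof -
    have "nths (event_seq \<sigma>) (P n) = map (event_id \<sigma>) (filter (\<lambda>i. snd (w ! i) = n) [0..<length w])" for n
      unfolding nths_event_seq P_def len by (intro arg_cong[where f = "map _"] filter_cong) auto
    then show ?thesis
      unfolding w(5) event_seq_reord[OF w(3)] order_def map_concat map_map w(1) by (simp add: comp_def)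
  qed
  moreover have "rf_equiv \<sigma> \<rho>" using rf_equiv_reord_iff w by blast
  ultimately show "sliced_reordering k \<sigma> \<rho>" unfolding sliced_reordering_def by blast
qed

text \<open>The quantifier over \<rho> disappears, as the annotation determines \<rho>; the one over
  annotations becomes an image under \<open>map fst\<close>.\<close>

lemma pre_sliced_eq:
  "pre_sliced T X k L =
    map fst ` {w \<in> lists (alphabet T X \<times> {1..k+1}). thread_mono w \<and> rf_ok w \<and> reord k w \<in> L}"
proof -
  have "w \<in> lists (A \<times> {1..k+1}) \<longleftrightarrow> map fst w \<in> lists A \<and> snd ` set w \<subseteq> {1..k+1}"
    for w :: "(('a, 'b) letter \<times> nat) list" and A
    by (induction w) auto
  then show ?thesis
    unfolding pre_sliced_def sliced_reordering_iff by auto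
qed

theorem theorem7p4:
  fixes T :: "'t set" and X :: "'x set" and L :: "('t, 'x) letter list set" and k :: nat
  assumes "finite T" and "finite X"
    and "regular_lang (alphabet T X) L"
    and "k \<ge> 1"
  shows "regular_lang (alphabet T X) (pre_sliced T X k L)"
  unfolding pre_sliced_eq by (rule regular_annotated[OF assms(1-3)])

end
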